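(* Let $\boldsymbol{\xi}=\{\xi_1,\dots,\xi_N\}$ be the finite scenario set with probabilities $\gamma_1,\dots,\gamma_N$, $F$ the two-stage objective, $d$ the problem-driven distance, and $M$ a constant with $\|z\|\le M$ for all $z\in Z$, under the standing assumptions in the context. Then there exists a non-decreasing function $h:[0,\infty)\to[0,\infty)$ such that $$|F(z,\xi)-F(z,\zeta)|\le h(\|z\|)\,d(\xi,\zeta)\qquad\text{for all } z\in Z,\ \xi,\zeta\in\boldsymbol{\xi},$$ and such that for every $K$, every partition $C_1,\dots,C_K$ of $\{1,\dots,N\}$ into nonempty clusters, and every choice of representative scenarios $\zeta_1,\dots,\zeta_K\in\boldsymbol{\xi}$ (with $\zeta_k$ representing $C_k$), the optimality gap $$OG:=F(z^*_{\boldsymbol{\zeta}},\boldsymbol{\xi})-F(z^*_{\boldsymbol{\xi}},\boldsymbol{\xi})$$ satisfies $$OG\le 2h(M)\sum_{k=1}^{K}\sum_{i\in C_k}\gamma_i\bigl(F(z^*_{\zeta_k},\xi_i)-F(z^*_{\xi_i},\xi_i)+F(z^*_{\xi_i},\zeta_k)-F(z^*_{\zeta_k},\zeta_k)\bigr).$$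
   Context: Setting (two-stage stochastic optimization). $Z\subseteq\mathbb{R}^n$ is a nonempty bounded feasible set of first-stage decisions. $\boldsymbol{\xi}=\{\xi_1,\dots,\xi_N\}$ is a finite set of $N$ distinct scenarios, each a vector in a fixed finite-dimensional Euclidean space, with probabilities $\gamma_i>0$, $\sum_{i=1}^N\gamma_i=1$. $f:Z\to\mathbb{R}$ is the first-stage objective; for $z\in Z$ and a scenario $\xi$, $Y(z,\xi)\subseteq\mathbb{R}^m$ is the second-stage feasible set and $g(y,\xi)$ the second-stage objective. For a single scenario, $F(z,\xi):=f(z)+\min_{y\in Y(z,\xi)}g(y,\xi)$. For the full scenario set, $F(z,\boldsymbol{\xi}):=\sum_{i=1}^N\gamma_iF(z,\xi_i)$. Given a partition $C_1,\dots,C_K$ of $\{1,\dots,N\}$ with representatives $\boldsymbol{\zeta}=(\zeta_1,\dots,\zeta_K)$, the weights are $\omega_k:=\sum_{i\in C_k}\gamma_i$ and $F(z,\boldsymbol{\zeta}):=\sum_{k=1}^K\omega_kF(z,\zeta_k)$. Denote $z^*_{\boldsymbol{\xi}}\in\arg\min_{z\in Z}F(z,\boldsymbol{\xi})$ and $z^*_{\boldsymbol{\zeta}}\in\arg\min_{z\in Z}F(z,\boldsymbol{\zeta})$; these minimizers are assumed to exist. For $\xi,\zeta\in\boldsymbol{\xi}$ the problem-driven distance is $d(\xi,\zeta):=F(z^*_{\zeta},\xi)-F(z^*_{\xi},\xi)+F(z^*_{\xi},\zeta)-F(z^*_{\zeta},\zeta)$, where $z^*_{\xi}$ is as in assumption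 3 below. Standing assumptions: 1. Relatively complete recourse: for every $z\in Z$ and $\xi\in\boldsymbol{\xi}$ the second-stage problem has a solution; moreover $F$ is bounded over all $z\in Z$ and $\xi\in\boldsymbol{\xi}$. 2. $F$ is locally Lipschitz continuous. 3. For each $\xi\in\boldsymbol{\xi}$, $z^*_{\xi}\in\arg\min_{z\in Z}F(z,\xi)$ exists. If this problem has multiple optimal solutions, $z^*_{\xi}$ denotes the one among them that minimizes $\sum_{\xi'\in\boldsymbol{\xi}}F(z,\xi')$; this selection is taken to be well defined (i.e. that minimizer, among the optimal solutions, exists and is unique). 4. Sensitivity assumption: for $\zeta,\xi\in\boldsymbol{\xi}$, $z^*_{\zeta}=z^*_{\xi}$ implies $\zeta=\xi$. *)

theory Defs
  imports "HOL-Analysis.Analysis"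
begin

text \<open>The minimum over the second stage is rendered by \<open>LEAST\<close>; it is meaningful whenever the
  second-stage problem has an optimal solution.\<close>

definition two_stage_objective ::
    "('z \<Rightarrow> real) \<Rightarrow> ('z \<Rightarrow> 's \<Rightarrow> 'y set) \<Rightarrow> ('y \<Rightarrow> 's \<Rightarrow> real) \<Rightarrow> 'z \<Rightarrow> 's \<Rightarrow> real" where
  "two_stage_objective f Y g z \<xi> = f z + (LEAST v. \<exists>y\<in>Y z \<xi>. v = g y \<xi>)"

definition relatively_complete_recourse ::
    "'z set \<Rightarrow> 's set \<Rightarrow> ('z \<Rightarrow> 's \<Rightarrow> 'y set) \<Rightarrow> ('y \<Rightarrow> 's \<Rightarrow> real) \<Rightarrow> bool" where
  "relatively_complete_recourse Z \<Xi> Y g \<longleftrightarrow>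
     (\<forall>z\<in>Z. \<forall>\<xi>\<in>\<Xi>. \<exists>y. is_arg_min (\<lambda>y. g y \<xi>) (\<lambda>y. y \<in> Y z \<xi>) y)"

definition weighted_objective ::
    "('z \<Rightarrow> 's \<Rightarrow> real) \<Rightarrow> 'i set \<Rightarrow> ('i \<Rightarrow> real) \<Rightarrow> ('i \<Rightarrow> 's) \<Rightarrow> 'z \<Rightarrow> real" where
  "weighted_objective F I w s z = (\<Sum>i\<in>I. w i * F z (s i))"

definition locally_lipschitz_on ::
    "'a::metric_space set \<Rightarrow> ('a \<Rightarrow> 'b::metric_space) \<Rightarrow> bool" where
  "locally_lipschitz_on S \<phi> \<longleftrightarrow> (\<forall>x\<in>S. \<exists>u>0. \<exists>L. L-lipschitz_on (ball x u \<inter> S) \<phi>)"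

text \<open>An optimal solution for the single scenario \<open>\<xi>\<close> which, among all optimal solutions for
  \<open>\<xi>\<close>, minimizes the (unweighted) sum of the objectives over the scenario set \<open>\<Xi>\<close>.\<close>

definition selected_solution ::
    "('z \<Rightarrow> 's \<Rightarrow> real) \<Rightarrow> 'z set \<Rightarrow> 's set \<Rightarrow> 's \<Rightarrow> 'z \<Rightarrow> bool" where
  "selected_solution F Z \<Xi> \<xi> z \<longleftrightarrow>
     is_arg_min (\<lambda>z. \<Sum>\<xi>'\<in>\<Xi>. F z \<xi>') (is_arg_min (\<lambda>z. F z \<xi>) (\<lambda>z. z \<in> Z)) z"

definition zstar ::
    "('z \<Rightarrow> 's \<Rightarrow> real) \<Rightarrow> 'z set \<Rightarrow> 's set \<Rightarrow> 's \<Rightarrow> 'z" where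
  "zstar F Z \<Xi> \<xi> = (THE z. selected_solution F Z \<Xi> \<xi> z)"

definition problem_distance ::
    "('z \<Rightarrow> 's \<Rightarrow> real) \<Rightarrow> 'z set \<Rightarrow> 's set \<Rightarrow> 's \<Rightarrow> 's \<Rightarrow> real" where
  "problem_distance F Z \<Xi> \<xi> \<zeta> =
     F (zstar F Z \<Xi> \<zeta>) \<xi> - F (zstar F Z \<Xi> \<xi>) \<xi> + F (zstar F Z \<Xi> \<xi>) \<zeta> - F (zstar F Z \<Xi> \<zeta>) \<zeta>"

definition indexed_partition :: "nat \<Rightarrow> nat \<Rightarrow> (nat \<Rightarrow> nat set) \<Rightarrow> bool" where
  "indexed_partition N K C \<longleftrightarrow>
     disjoint_family_on C {1..K} \<and> (\<forall>k\<in>{1..K}. C k \<noteq> {}) \<and> (\<Union>k\<in>{1..K}. C k) = {1..N}"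

end

theory Submission
  imports Defs
begin

text \<open>
  The problem-driven distance is a sum of two regrets: the loss from using the solution of \<open>t\<close>
  under scenario \<open>s\<close>, plus the loss from using the solution of \<open>s\<close> under \<open>t\<close>. Both are
  nonnegative, and if their sum vanishes then the two selected solutions are optimal for both
  scenarios. Each of them is then admissible in the tie-breaking of the other, so they have the same
  total objective over all scenarios, and uniqueness of the selection makes them equal; by the
  sensitivity assumption the scenarios are equal. Hence distinct scenarios have positive distance
  (\<open>problem_distance_pos\<close>).

  As there are finitely many scenarios and \<open>F\<close> is bounded, any two values \<open>F z s\<close> and \<open>F z t\<close>
  differ by at most a fixed multiple of the distance, uniformly in \<open>z\<close>
  (\<open>uniform_bound_by_positive_distance\<close>). So a constant function \<open>h\<close> suffices.

  For the optimality gap, both weighted objectives are written as sums over pairs of a cluster and a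
  scenario in it (\<open>sum_indexed_partition\<close>). At a fixed \<open>z\<close> they then differ by at most \<open>h\<close>
  times the weighted sum of the distances (\<open>clustered_objective_error\<close>). The usual comparison of
  minimizers of two uniformly close functions uses this estimate at each of the two minimizers,
  which gives the factor 2.
\<close>

section \<open>Positivity of the problem-driven distance\<close>

lemma zstar_selected:
  assumes "\<exists>!z. selected_solution F Z \<Xi> s z"
  shows "selected_solution F Z \<Xi> s (zstar F Z \<Xi> s)"
  unfolding zstar_def using assms by (rule theI')

lemma selected_solution_mem:
  "selected_solution F Z \<Xi> s z \<Longrightarrow> z \<in> Z"
  by (auto simp: selected_solution_def is_arg_min_def)

lemma selected_solution_optimal:
  fixes F :: "'z \<Rightarrow> 's \<Rightarrow> real"
  shows "selected_solution F Z \<Xi> s z \<Longrightarrow> w \<in> Z \<Longrightarrow> F z s \<le> F w s"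
  by (force simp: selected_solution_def is_arg_min_def)

text \<open>The two hypotheses on \<open>F\<close> make both solutions optimal for both scenarios. The tie-breaking
  criterion, the total over \<open>\<Xi>\<close>, is the same for every scenario, so each solution competes in the
  selection of the other and their totals agree; uniqueness then identifies them.\<close>

lemma selected_solutions_eq_if_mutually_optimal:
  fixes F :: "'z \<Rightarrow> 's \<Rightarrow> real"
  assumes x: "selected_solution F Z \<Xi> s x"
    and y: "selected_solution F Z \<Xi> t y"
    and uniq: "\<exists>!z. selected_solution F Z \<Xi> s z"
    and "F y s \<le> F x s" and "F x t \<le> F y t"
  shows "x = y"
proof -
  have opt_y: "is_arg_min (\<lambda>z. F z s) (\<lambda>z. z \<in> Z) y"
    using assms(4) selected_solution_optimal[OF x] selected_solution_mem[OF y]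
    by (force simp: is_arg_min_def)
  have opt_x: "is_arg_min (\<lambda>z. F z t) (\<lambda>z. z \<in> Z) x"
    using assms(5) selected_solution_optimal[OF y] selected_solution_mem[OF x]
    by (force simp: is_arg_min_def)
  have "(\<Sum>r\<in>\<Xi>. F y r) \<le> (\<Sum>r\<in>\<Xi>. F x r)"
    using y opt_x unfolding selected_solution_def is_arg_min_linorder by blast
  moreover have "\<forall>w. is_arg_min (\<lambda>z. F z s) (\<lambda>z. z \<in> Z) w \<longrightarrow>
      (\<Sum>r\<in>\<Xi>. F x r) \<le> (\<Sum>r\<in>\<Xi>. F w r)"
    using x unfolding selected_solution_def by (subst (asm) is_arg_min_linorder) blast
  ultimately have "selected_solution F Z \<Xi> s y"
    unfolding selected_solution_def
    by (subst is_arg_min_linorder) (use opt_y order_trans in blast)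
  with x uniq show "x = y" by blast
qed

lemma problem_distance_pos:
  fixes F :: "'z \<Rightarrow> 's \<Rightarrow> real"
  assumes selection: "\<forall>s\<in>\<Xi>. \<exists>!z. selected_solution F Z \<Xi> s z"
    and sensitivity: "\<forall>s\<in>\<Xi>. \<forall>t\<in>\<Xi>. zstar F Z \<Xi> t = zstar F Z \<Xi> s \<longrightarrow> t = s"
    and "s \<in> \<Xi>" "t \<in> \<Xi>" "s \<noteq> t"
  shows "0 < problem_distance F Z \<Xi> s t"
proof (rule ccontr)
  assume neg: "\<not> ?thesis"
  let ?x = "zstar F Z \<Xi> s" and ?y = "zstar F Z \<Xi> t"
  have x: "selected_solution F Z \<Xi> s ?x" and y: "selected_solution F Z \<Xi> t ?y"
    using selection assms(3,4) by (simp_all add: zstar_selected)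
  have "F ?x s \<le> F ?y s" "F ?y t \<le> F ?x t"
    using selected_solution_optimal selected_solution_mem x y by metis+
  with neg have "F ?y s \<le> F ?x s" "F ?x t \<le> F ?y t"
    unfolding problem_distance_def by linarith+
  then have "?x = ?y"
    using selected_solutions_eq_if_mutually_optimal[OF x y] selection assms(3) by blast
  with sensitivity assms(3-5) show False by metis
qed

section \<open>A uniform Lipschitz-type constant\<close>

text \<open>On a finite set of scenarios, positivity off the diagonal already bounds the distances away
  from zero; summing the reciprocals of all distances gives a constant that serves every pair.\<close>

lemma uniform_bound_by_positive_distance:
  fixes F :: "'z \<Rightarrow> 's \<Rightarrow> real" and d :: "'s \<Rightarrow> 's \<Rightarrow> real"
  assumes "finite \<Xi>"
    and bdd: "bounded ((\<lambda>(z, s). F z s) ` (Z \<times> \<Xi>))"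
    and pos: "\<And>s t. s \<in> \<Xi> \<Longrightarrow> t \<in> \<Xi> \<Longrightarrow> s \<noteq> t \<Longrightarrow> 0 < d s t"
    and diag: "\<And>s. s \<in> \<Xi> \<Longrightarrow> d s s = 0"
  shows "\<exists>H\<ge>0. \<forall>z\<in>Z. \<forall>s\<in>\<Xi>. \<forall>t\<in>\<Xi>. \<bar>F z s - F z t\<bar> \<le> H * d s t"
proof -
  obtain B where B: "0 < B" "\<And>z s. z \<in> Z \<Longrightarrow> s \<in> \<Xi> \<Longrightarrow> \<bar>F z s\<bar> \<le> B"
    using bdd unfolding bounded_pos by fastforce
  define R where "R = (\<Sum>(s, t)\<in>\<Xi> \<times> \<Xi>. 1 / d s t)"
  \<comment> \<open>Diagonal terms of the sum are \<open>1 / 0 = 0\<close>.\<close>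
  have nonneg: "0 \<le> 1 / d s t" if "s \<in> \<Xi>" "t \<in> \<Xi>" for s t
    using pos[OF that] diag[of s] that by (cases "s = t") force+
  have R: "1 / d s t \<le> R" if "s \<in> \<Xi>" "t \<in> \<Xi>" for s t
  proof -
    have "(\<lambda>(s, t). 1 / d s t) (s, t) \<le> R"
      unfolding R_def
      by (rule member_le_sum) (use that nonneg \<open>finite \<Xi>\<close> in auto)
    then show ?thesis by simp
  qed
  have "0 \<le> R"
    unfolding R_def using nonneg by (intro sum_nonneg) auto
  moreover have "\<bar>F z s - F z t\<bar> \<le> 2 * B * R * d s t" if "z \<in> Z" "s \<in> \<Xi>" "t \<in> \<Xi>" for z s t
  proof (cases "s = t")
    case True
    then show ?thesis using diag that by simp
  next
    case False
    with pos that have "0 < d s t" by blast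
    then have "1 \<le> R * d s t"
      using R[OF that(2,3)] by (simp add: pos_divide_le_eq)
    then have "2 * B * 1 \<le> 2 * B * (R * d s t)"
      using B(1) by (intro mult_left_mono) auto
    moreover have "\<bar>F z s - F z t\<bar> \<le> 2 * B"
      using B(2)[OF that(1,2)] B(2)[OF that(1,3)] by linarith
    ultimately show ?thesis by (simp add: mult.assoc)
  qed
  ultimately show ?thesis
    using B(1) by (intro exI[of _ "2 * B * R"]) auto
qed

section \<open>Error of a clustered objective\<close>

lemma sum_indexed_partition:
  fixes \<phi> :: "nat \<Rightarrow> 'a::comm_monoid_add"
  assumes "indexed_partition N K C"
  shows "(\<Sum>i\<in>{1..N}. \<phi> i) = (\<Sum>k\<in>{1..K}. \<Sum>i\<in>C k. \<phi> i)"
proof -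
  have un: "(\<Union>k\<in>{1..K}. C k) = {1..N}" and disj: "disjoint_family_on C {1..K}"
    using assms by (auto simp: indexed_partition_def)
  have "finite (C k)" if "k \<in> {1..K}" for k
    using un that by (intro finite_subset[of "C k" "{1..N}"]) auto
  then show ?thesis
    unfolding un[symmetric]
    using disj by (intro sum.UNION_disjoint) (auto simp: disjoint_family_on_def)
qed

text \<open>A cluster weight is the sum of the scenario probabilities in it, so both objectives
  distribute over the same pairs and can be compared term by term.\<close>

lemma clustered_objective_error:
  assumes part: "indexed_partition N K C"
    and nonneg: "\<And>i. i \<in> {1..N} \<Longrightarrow> 0 \<le> \<gamma> i"
    and close: "\<And>k i. k \<in> {1..K} \<Longrightarrow> i \<in> C k \<Longrightarrow> \<bar>F z (\<xi> i) - F z (\<zeta> k)\<bar> \<le> H * D k i"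
  shows "\<bar>weighted_objective F {1..N} \<gamma> \<xi> z -
            weighted_objective F {1..K} (\<lambda>k. \<Sum>i\<in>C k. \<gamma> i) \<zeta> z\<bar>
         \<le> H * (\<Sum>k\<in>{1..K}. \<Sum>i\<in>C k. \<gamma> i * D k i)"
proof -
  have in_range: "i \<in> {1..N}" if "k \<in> {1..K}" "i \<in> C k" for k i
    using part that by (auto simp: indexed_partition_def)
  have "weighted_objective F {1..N} \<gamma> \<xi> z -
          weighted_objective F {1..K} (\<lambda>k. \<Sum>i\<in>C k. \<gamma> i) \<zeta> z
        = (\<Sum>k\<in>{1..K}. \<Sum>i\<in>C k. \<gamma> i * (F z (\<xi> i) - F z (\<zeta> k)))"
    unfolding weighted_objective_def sum_indexed_partition[OF part]
    by (simp add: sum_distrib_right sum_subtractf right_diff_distrib)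
  also have "\<bar>\<dots>\<bar> \<le> (\<Sum>k\<in>{1..K}. \<Sum>i\<in>C k. \<gamma> i * (H * D k i))"
  proof (intro order_trans[OF sum_abs] sum_mono)
    fix k i assume "k \<in> {1..K}" "i \<in> C k"
    then show "\<bar>\<gamma> i * (F z (\<xi> i) - F z (\<zeta> k))\<bar> \<le> \<gamma> i * (H * D k i)"
      using close nonneg in_range by (simp add: abs_mult mult_left_mono)
  qed
  also have "\<dots> = H * (\<Sum>k\<in>{1..K}. \<Sum>i\<in>C k. \<gamma> i * D k i)"
    by (simp add: sum_distrib_left mult.left_commute)
  finally show ?thesis .
qed

section \<open>The optimality gap of a clustering\<close>

theorem mainTheorem2:
  fixes Z :: "(real ^ 'n) set"
    and N :: nat
    and \<xi> :: "nat \<Rightarrow> real ^ 'p"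
    and \<Xi> :: "(real ^ 'p) set"
    and \<gamma> :: "nat \<Rightarrow> real"
    and f :: "real ^ 'n \<Rightarrow> real"
    and Y :: "real ^ 'n \<Rightarrow> real ^ 'p \<Rightarrow> (real ^ 'm) set"
    and g :: "real ^ 'm \<Rightarrow> real ^ 'p \<Rightarrow> real"
    and F :: "real ^ 'n \<Rightarrow> real ^ 'p \<Rightarrow> real"
    and M :: real
  assumes "Z \<noteq> {}" and "bounded Z"
    and distinct_scenarios: "inj_on \<xi> {1..N}"
    and scenario_set: "\<Xi> = \<xi> ` {1..N}"
    and gamma_pos: "\<forall>i\<in>{1..N}. \<gamma> i > 0"
    and gamma_sum: "(\<Sum>i\<in>{1..N}. \<gamma> i) = 1"
    and F_eq: "F = two_stage_objective f Y g"
    and recourse: "relatively_complete_recourse Z \<Xi> Y g"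
    and F_bounded: "bounded ((\<lambda>(z, s). F z s) ` (Z \<times> \<Xi>))"
    and F_lipschitz: "locally_lipschitz_on (Z \<times> \<Xi>) (\<lambda>(z, s). F z s)"
    and selection: "\<forall>s\<in>\<Xi>. \<exists>!z. selected_solution F Z \<Xi> s z"
    and sensitivity: "\<forall>s\<in>\<Xi>. \<forall>t\<in>\<Xi>. zstar F Z \<Xi> t = zstar F Z \<Xi> s \<longrightarrow> t = s"
    and M_bound: "\<forall>z\<in>Z. norm z \<le> M"
  shows "\<exists>h :: real \<Rightarrow> real.
     mono_on {0..} h \<and> (\<forall>t\<ge>0. h t \<ge> 0) \<and>
     (\<forall>z\<in>Z. \<forall>s\<in>\<Xi>. \<forall>t\<in>\<Xi>.
        \<bar>F z s - F z t\<bar> \<le> h (norm z) * problem_distance F Z \<Xi> s t) \<and>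
     (\<forall>(K :: nat) (C :: nat \<Rightarrow> nat set) (\<zeta> :: nat \<Rightarrow> real ^ 'p) z\<xi> z\<zeta>.
        indexed_partition N K C \<longrightarrow>
        (\<forall>k\<in>{1..K}. \<zeta> k \<in> \<Xi>) \<longrightarrow>
        is_arg_min (weighted_objective F {1..N} \<gamma> \<xi>) (\<lambda>z. z \<in> Z) z\<xi> \<longrightarrow>
        is_arg_min (weighted_objective F {1..K} (\<lambda>k. \<Sum>i\<in>C k. \<gamma> i) \<zeta>) (\<lambda>z. z \<in> Z) z\<zeta> \<longrightarrow>
        weighted_objective F {1..N} \<gamma> \<xi> z\<zeta> - weighted_objective F {1..N} \<gamma> \<xi> z\<xi>
        \<le> 2 * h M * (\<Sum>k\<in>{1..K}. \<Sum>i\<in>C k. \<gamma> i *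
             (F (zstar F Z \<Xi> (\<zeta> k)) (\<xi> i) - F (zstar F Z \<Xi> (\<xi> i)) (\<xi> i)
              + F (zstar F Z \<Xi> (\<xi> i)) (\<zeta> k) - F (zstar F Z \<Xi> (\<zeta> k)) (\<zeta> k))))"
proof -
  let ?d = "problem_distance F Z \<Xi>"
  have "finite \<Xi>" using scenario_set by simp
  then obtain H where "0 \<le> H"
    and H: "\<And>z s t. z \<in> Z \<Longrightarrow> s \<in> \<Xi> \<Longrightarrow> t \<in> \<Xi> \<Longrightarrow> \<bar>F z s - F z t\<bar> \<le> H * ?d s t"
    using uniform_bound_by_positive_distance[of \<Xi> F Z ?d] F_bounded
      problem_distance_pos[OF selection sensitivity]
    by (auto simp: problem_distance_def)
  have gap: "weighted_objective F {1..N} \<gamma> \<xi> z\<zeta> - weighted_objective F {1..N} \<gamma> \<xi> z\<xi>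
      \<le> 2 * H * (\<Sum>k\<in>{1..K}. \<Sum>i\<in>C k. \<gamma> i * ?d (\<xi> i) (\<zeta> k))"
    if part: "indexed_partition N K C" and reps: "\<forall>k\<in>{1..K}. \<zeta> k \<in> \<Xi>"
      and min_full: "is_arg_min (weighted_objective F {1..N} \<gamma> \<xi>) (\<lambda>z. z \<in> Z) z\<xi>"
      and min_reps:
        "is_arg_min (weighted_objective F {1..K} (\<lambda>k. \<Sum>i\<in>C k. \<gamma> i) \<zeta>) (\<lambda>z. z \<in> Z) z\<zeta>"
    for K C \<zeta> z\<xi> z\<zeta>
  proof -
    let ?full = "weighted_objective F {1..N} \<gamma> \<xi>"
    let ?reps = "weighted_objective F {1..K} (\<lambda>k. \<Sum>i\<in>C k. \<gamma> i) \<zeta>"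
    let ?S = "\<Sum>k\<in>{1..K}. \<Sum>i\<in>C k. \<gamma> i * ?d (\<xi> i) (\<zeta> k)"
    have "\<xi> i \<in> \<Xi>" if "k \<in> {1..K}" "i \<in> C k" for k i
      using part that scenario_set by (auto simp: indexed_partition_def)
    then have err: "\<bar>?full z - ?reps z\<bar> \<le> H * ?S" if "z \<in> Z" for z
      using that reps gamma_pos
      by (intro clustered_objective_error[OF part]) (auto intro: H less_imp_le)
    have "z\<xi> \<in> Z" "z\<zeta> \<in> Z" "?reps z\<zeta> \<le> ?reps z\<xi>"
      using min_full min_reps by (auto simp: is_arg_min_linorder)
    then show ?thesis using err[of z\<xi>] err[of z\<zeta>] by linarith
  qed
  show ?thesis
  proof (intro exI[of _ "\<lambda>_. H"] conjI allI impI ballI)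
    show "mono_on {0..} (\<lambda>_::real. H)" by (simp add: mono_on_def)
  qed (use \<open>0 \<le> H\<close> H gap in \<open>simp_all add: problem_distance_def\<close>)
qed

end
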